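(* Let $\alpha_n=s_n/\lambda_n$. In the case a termination behaviour occurs, the termination condition $$\alpha_N(x)-\alpha_{N-1}(x)=0$$ on $I$, for some positive integer $N$, can be replaced by the equivalent condition $$q_N(x)=0\quad\text{for all }x\in I,$$ with $N$ some positive integer.
   Context: Let $I\subseteq\mathbb{R}$ be an interval and $\lambda_0,s_0\in C^\infty(I)$, with $\lambda_0(x)\neq 0$ for all $x\in I$; these are the coefficients of the ODE $y''=\lambda_0 y'+s_0 y$, to which the asymptotic iteration method (AIM) is applied. Functions $\lambda_n,s_n$, for $n\ge1$: $\lambda_n=\lambda_{n-1}'+\lambda_0\lambda_{n-1}+s_{n-1}$ and $s_n=s_{n-1}'+s_0\lambda_{n-1}$. Functions $p_n,q_n$: $p_0=\lambda_0$, $q_0=s_0$, and for $n\ge1$ $$p_n=p_{n-1}+\frac{q_{n-1}'}{q_{n-1}},\qquad q_n=q_{n-1}+p_{n-1}'-p_{n-1}\frac{q_{n-1}'}{q_{n-1}}.$$ *)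

theory Defs
  imports "HOL-Analysis.Analysis"
begin

(* Derivatives are taken within I, hence one-sided at an endpoint belonging to I.
   They are only determined when no point of I is isolated in I, i.e. when the
   interval I is nondegenerate. *)
definition deriv_in :: "real set \<Rightarrow> (real \<Rightarrow> real) \<Rightarrow> real \<Rightarrow> real" where
  "deriv_in I f = (\<lambda>x. vector_derivative f (at x within I))"

definition smooth_in :: "real set \<Rightarrow> (real \<Rightarrow> real) \<Rightarrow> bool" where
  "smooth_in I f \<longleftrightarrow> (\<forall>n. ((deriv_in I ^^ n) f) differentiable_on I)"

fun aim_lambda :: "real set \<Rightarrow> (real \<Rightarrow> real) \<Rightarrow> (real \<Rightarrow> real) \<Rightarrow> nat \<Rightarrow> real \<Rightarrow> real"
  and aim_s :: "real set \<Rightarrow> (real \<Rightarrow> real) \<Rightarrow> (real \<Rightarrow> real) \<Rightarrow> nat \<Rightarrow> real \<Rightarrow> real"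
where
  "aim_lambda I l\<^sub>0 s\<^sub>0 0 = l\<^sub>0"
| "aim_lambda I l\<^sub>0 s\<^sub>0 (Suc n) =
    (\<lambda>x. deriv_in I (aim_lambda I l\<^sub>0 s\<^sub>0 n) x + l\<^sub>0 x * aim_lambda I l\<^sub>0 s\<^sub>0 n x + aim_s I l\<^sub>0 s\<^sub>0 n x)"
| "aim_s I l\<^sub>0 s\<^sub>0 0 = s\<^sub>0"
| "aim_s I l\<^sub>0 s\<^sub>0 (Suc n) =
    (\<lambda>x. deriv_in I (aim_s I l\<^sub>0 s\<^sub>0 n) x + s\<^sub>0 x * aim_lambda I l\<^sub>0 s\<^sub>0 n x)"

fun aim_p :: "real set \<Rightarrow> (real \<Rightarrow> real) \<Rightarrow> (real \<Rightarrow> real) \<Rightarrow> nat \<Rightarrow> real \<Rightarrow> real"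
  and aim_q :: "real set \<Rightarrow> (real \<Rightarrow> real) \<Rightarrow> (real \<Rightarrow> real) \<Rightarrow> nat \<Rightarrow> real \<Rightarrow> real"
where
  "aim_p I l\<^sub>0 s\<^sub>0 0 = l\<^sub>0"
| "aim_p I l\<^sub>0 s\<^sub>0 (Suc n) =
    (\<lambda>x. aim_p I l\<^sub>0 s\<^sub>0 n x + deriv_in I (aim_q I l\<^sub>0 s\<^sub>0 n) x / aim_q I l\<^sub>0 s\<^sub>0 n x)"
| "aim_q I l\<^sub>0 s\<^sub>0 0 = s\<^sub>0"
| "aim_q I l\<^sub>0 s\<^sub>0 (Suc n) =
    (\<lambda>x. aim_q I l\<^sub>0 s\<^sub>0 n x + deriv_in I (aim_p I l\<^sub>0 s\<^sub>0 n) x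
       - aim_p I l\<^sub>0 s\<^sub>0 n x * (deriv_in I (aim_q I l\<^sub>0 s\<^sub>0 n) x / aim_q I l\<^sub>0 s\<^sub>0 n x))"

definition aim_alpha :: "real set \<Rightarrow> (real \<Rightarrow> real) \<Rightarrow> (real \<Rightarrow> real) \<Rightarrow> nat \<Rightarrow> real \<Rightarrow> real" where
  "aim_alpha I l\<^sub>0 s\<^sub>0 n = (\<lambda>x. aim_s I l\<^sub>0 s\<^sub>0 n x / aim_lambda I l\<^sub>0 s\<^sub>0 n x)"

(* Since division is total in HOL, well-definedness of the quotients on all of I
   has to be expressed separately. *)
definition aim_alpha_defined :: "real set \<Rightarrow> (real \<Rightarrow> real) \<Rightarrow> (real \<Rightarrow> real) \<Rightarrow> nat \<Rightarrow> bool" where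
  "aim_alpha_defined I l\<^sub>0 s\<^sub>0 n \<longleftrightarrow> (\<forall>x\<in>I. aim_lambda I l\<^sub>0 s\<^sub>0 n x \<noteq> 0)"

definition aim_pq_defined :: "real set \<Rightarrow> (real \<Rightarrow> real) \<Rightarrow> (real \<Rightarrow> real) \<Rightarrow> nat \<Rightarrow> bool" where
  "aim_pq_defined I l\<^sub>0 s\<^sub>0 n \<longleftrightarrow> (\<forall>k<n. \<forall>x\<in>I. aim_q I l\<^sub>0 s\<^sub>0 k x \<noteq> 0)"

definition alpha_terminates :: "real set \<Rightarrow> (real \<Rightarrow> real) \<Rightarrow> (real \<Rightarrow> real) \<Rightarrow> nat \<Rightarrow> bool" where
  "alpha_terminates I l\<^sub>0 s\<^sub>0 N \<longleftrightarrow>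
     (\<forall>x\<in>I. aim_alpha I l\<^sub>0 s\<^sub>0 N x - aim_alpha I l\<^sub>0 s\<^sub>0 (N - 1) x = 0)"

definition q_terminates :: "real set \<Rightarrow> (real \<Rightarrow> real) \<Rightarrow> (real \<Rightarrow> real) \<Rightarrow> nat \<Rightarrow> bool" where
  "q_terminates I l\<^sub>0 s\<^sub>0 N \<longleftrightarrow> (\<forall>x\<in>I. aim_q I l\<^sub>0 s\<^sub>0 N x = 0)"

end

(* If y'' = l0 y' + s0 y, then repeated differentiation gives
   y^(n+2) = lambda_n y' + s_n y, and also y^(n+2) = p_n y^(n+1) + q_n y^(n).
   Both coefficient sequences (lambda_n) and (s_n), extended by lambda_(-1) = 1, s_(-1) = 0,
   lambda_(-2) = 0, s_(-2) = 1, therefore satisfy v_n = p_n v_(n-1) + q_n v_(n-2).  Hence the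
   determinant lambda_n s_(n-1) - s_n lambda_(n-1) is q_0 ... q_n up to sign. *)
theory Submission
  imports Defs
begin

section \<open>Finite and infinite order differentiability relative to a set\<close>

fun differentiable_times_in :: "real set \<Rightarrow> nat \<Rightarrow> (real \<Rightarrow> real) \<Rightarrow> bool" where
  "differentiable_times_in I 0 f \<longleftrightarrow> f differentiable_on I"
| "differentiable_times_in I (Suc n) f \<longleftrightarrow>
     f differentiable_on I \<and> differentiable_times_in I n (deriv_in I f)"

text \<open>Trades iterates of \<open>deriv_in\<close> for a recursion on the first derivative,
  which suits induction on the order in the product and inverse rules. Level \<open>n\<close> makes
  the derivatives of orders 0 to \<open>n\<close> differentiable, so it stands for order
  \<open>n + 1\<close>.\<close>

lemma smooth_in_iff: "smooth_in I f \<longleftrightarrow> (\<forall>n. differentiable_times_in I n f)"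
proof -
  have "differentiable_times_in I n f \<longleftrightarrow> (\<forall>k\<le>n. ((deriv_in I ^^ k) f) differentiable_on I)" for n
  proof (induction n arbitrary: f)
    case (Suc n)
    have "(\<forall>k\<le>Suc n. P k) \<longleftrightarrow> P 0 \<and> (\<forall>k\<le>n. P (Suc k))" for P
      using less_Suc_eq_0_disj by (auto simp: less_Suc_eq_le[symmetric])
    with Suc show ?case by (simp add: funpow_swap1)
  qed simp
  then show ?thesis by (auto simp: smooth_in_def)
qed

lemma differentiable_times_in_imp_differentiable_on:
  "differentiable_times_in I n f \<Longrightarrow> f differentiable_on I"
  by (cases n) auto

lemma differentiable_times_in_Suc_imp:
  "differentiable_times_in I (Suc n) f \<Longrightarrow> differentiable_times_in I n f"
  by (induction n arbitrary: f) (auto intro: differentiable_times_in_imp_differentiable_on)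

text \<open>The filter \<open>at x within I\<close> sees only points of \<open>I\<close>. Functions
  here are total on the reals but their identities hold only on \<open>I\<close>, so every later
  differentiation of an identity passes through this congruence.\<close>

lemma deriv_in_cong:
  assumes "\<And>x. x \<in> I \<Longrightarrow> f x = g x" "x \<in> I"
  shows "deriv_in I f x = deriv_in I g x"
proof -
  have "(f has_vector_derivative d) (at x within I) \<longleftrightarrow>
        (g has_vector_derivative d) (at x within I)" for d
    by (intro has_vector_derivative_cong_ev) (use assms in \<open>auto simp: eventually_at_filter\<close>)
  then show ?thesis by (simp add: deriv_in_def vector_derivative_def)
qed

lemma differentiable_on_cong:
  assumes "\<And>x. x \<in> I \<Longrightarrow> f x = g x"
  shows "f differentiable_on I \<longleftrightarrow> g differentiable_on I"
  using assms differentiable_transform_within[of _ _ I 1]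
  by (metis differentiable_on_def zero_less_one)

lemma differentiable_times_in_cong:
  assumes "\<And>x. x \<in> I \<Longrightarrow> f x = g x"
  shows "differentiable_times_in I n f \<longleftrightarrow> differentiable_times_in I n g"
  using assms
proof (induction n arbitrary: f g)
  case 0
  then show ?case using differentiable_on_cong[of I f g] by simp
next
  case (Suc n)
  have "f differentiable_on I \<longleftrightarrow> g differentiable_on I"
    using Suc.prems by (rule differentiable_on_cong)
  moreover have "differentiable_times_in I n (deriv_in I f) \<longleftrightarrow> differentiable_times_in I n (deriv_in I g)"
    by (intro Suc.IH deriv_in_cong Suc.prems)
  ultimately show ?case by simp
qed

lemma has_real_derivative_deriv_in:
  assumes "f differentiable_on I" "x \<in> I"
  shows "(f has_real_derivative deriv_in I f x) (at x within I)"
  using assms unfolding deriv_in_def differentiable_on_def has_real_derivative_iff_has_vector_derivative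
  by (simp add: vector_derivative_works)

text \<open>A nontrivial \<open>at x within I\<close> means that \<open>x\<close> is an accumulation
  point of \<open>I\<close>. Derivatives within \<open>I\<close> are then unique, and the chosen
  value \<open>deriv_in\<close> is the computed one.\<close>

locale perfect_set =
  fixes I :: "real set"
  assumes not_bot: "x \<in> I \<Longrightarrow> at x within I \<noteq> bot"
begin

lemma deriv_in_eqI:
  assumes "(f has_real_derivative d) (at x within I)" "x \<in> I"
  shows "deriv_in I f x = d"
  using assms not_bot
  by (simp add: deriv_in_def has_real_derivative_iff_has_vector_derivative vector_derivative_within)

lemma deriv_in_const: "x \<in> I \<Longrightarrow> deriv_in I (\<lambda>x. c) x = 0"
  by (rule deriv_in_eqI) auto

lemma deriv_in_add:
  assumes "f differentiable_on I" "g differentiable_on I" "x \<in> I"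
  shows "deriv_in I (\<lambda>x. f x + g x) x = deriv_in I f x + deriv_in I g x"
  by (rule deriv_in_eqI)
    (use assms in \<open>auto intro!: derivative_eq_intros has_real_derivative_deriv_in\<close>)

lemma deriv_in_mult:
  assumes "f differentiable_on I" "g differentiable_on I" "x \<in> I"
  shows "deriv_in I (\<lambda>x. f x * g x) x = deriv_in I f x * g x + f x * deriv_in I g x"
  by (rule deriv_in_eqI)
    (use assms in \<open>auto intro!: derivative_eq_intros has_real_derivative_deriv_in\<close>)

text \<open>The usual \<open>- f' / f^2\<close> is spelled as a product of constants,
  \<open>f'\<close> and \<open>inverse f\<close>, so that the closure rules for constants and
  products apply to it directly.\<close>

lemma deriv_in_inverse:
  assumes "f differentiable_on I" "f x \<noteq> 0" "x \<in> I"
  shows "deriv_in I (\<lambda>x. inverse (f x)) x = (- 1) * (deriv_in I f x * (inverse (f x) * inverse (f x)))"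
  by (rule deriv_in_eqI)
    (use assms in \<open>auto intro!: derivative_eq_intros has_real_derivative_deriv_in\<close>)

lemma differentiable_times_in_const: "differentiable_times_in I n (\<lambda>x. c)"
proof (induction n arbitrary: c)
  case (Suc n)
  have "differentiable_times_in I n (deriv_in I (\<lambda>x. c))"
    using Suc[of 0] by (subst differentiable_times_in_cong[where g = "\<lambda>x. 0"]) (auto simp: deriv_in_const)
  then show ?case by simp
qed simp

lemma differentiable_times_in_add:
  assumes "differentiable_times_in I n f" "differentiable_times_in I n g"
  shows "differentiable_times_in I n (\<lambda>x. f x + g x)"
  using assms
proof (induction n arbitrary: f g)
  case 0
  then show ?case by (simp add: differentiable_on_add)
next
  case (Suc n)
  then have "differentiable_times_in I n (deriv_in I (\<lambda>x. f x + g x))"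
    by (subst differentiable_times_in_cong[where g = "\<lambda>x. deriv_in I f x + deriv_in I g x"])
      (auto simp: deriv_in_add)
  with Suc.prems show ?case by (simp add: differentiable_on_add)
qed

lemma differentiable_times_in_mult:
  assumes "differentiable_times_in I n f" "differentiable_times_in I n g"
  shows "differentiable_times_in I n (\<lambda>x. f x * g x)"
  using assms
proof (induction n arbitrary: f g)
  case 0
  then show ?case by (simp add: differentiable_on_mult)
next
  case (Suc n)
  have "differentiable_times_in I n (\<lambda>x. deriv_in I f x * g x + f x * deriv_in I g x)"
    using Suc.prems[THEN differentiable_times_in_Suc_imp] Suc.prems
    by (intro differentiable_times_in_add Suc.IH) auto
  then have "differentiable_times_in I n (deriv_in I (\<lambda>x. f x * g x))"
    using Suc.prems
    by (subst differentiable_times_in_cong) (auto simp: deriv_in_mult)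
  with Suc.prems show ?case by (simp add: differentiable_on_mult)
qed

text \<open>The derivative of \<open>inverse f\<close> involves only \<open>f'\<close> and
  \<open>inverse f\<close> itself, so the induction hypothesis for the same \<open>f\<close>
  suffices.\<close>

lemma differentiable_times_in_inverse:
  assumes "differentiable_times_in I n f" "\<And>x. x \<in> I \<Longrightarrow> f x \<noteq> 0"
  shows "differentiable_times_in I n (\<lambda>x. inverse (f x))"
  using assms(1)
proof (induction n)
  case 0
  then show ?case using assms(2) by (simp add: differentiable_on_inverse)
next
  case (Suc n)
  have "differentiable_times_in I n (\<lambda>x. (- 1) * (deriv_in I f x * (inverse (f x) * inverse (f x))))"
    using Suc.prems Suc.IH[OF differentiable_times_in_Suc_imp[OF Suc.prems]]
    by (intro differentiable_times_in_mult differentiable_times_in_const) auto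
  then have "differentiable_times_in I n (deriv_in I (\<lambda>x. inverse (f x)))"
    using Suc.prems assms(2)
    by (subst differentiable_times_in_cong) (auto simp: deriv_in_inverse)
  with Suc.prems assms(2) show ?case by (simp add: differentiable_on_inverse)
qed

lemma smooth_in_imp_differentiable_on: "smooth_in I f \<Longrightarrow> f differentiable_on I"
  by (metis smooth_in_iff differentiable_times_in.simps(1))

lemma smooth_in_deriv_in: "smooth_in I f \<Longrightarrow> smooth_in I (deriv_in I f)"
  by (metis smooth_in_iff differentiable_times_in.simps(2))

lemma smooth_in_const: "smooth_in I (\<lambda>x. c)"
  by (simp add: smooth_in_iff differentiable_times_in_const)

lemma smooth_in_add: "smooth_in I f \<Longrightarrow> smooth_in I g \<Longrightarrow> smooth_in I (\<lambda>x. f x + g x)"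
  by (simp add: smooth_in_iff differentiable_times_in_add)

lemma smooth_in_mult: "smooth_in I f \<Longrightarrow> smooth_in I g \<Longrightarrow> smooth_in I (\<lambda>x. f x * g x)"
  by (simp add: smooth_in_iff differentiable_times_in_mult)

lemma smooth_in_diff: "smooth_in I f \<Longrightarrow> smooth_in I g \<Longrightarrow> smooth_in I (\<lambda>x. f x - g x)"
  using smooth_in_add[of f "\<lambda>x. (- 1) * g x"] smooth_in_mult[OF smooth_in_const, of g "- 1"] by simp

lemma smooth_in_divide:
  "smooth_in I f \<Longrightarrow> smooth_in I g \<Longrightarrow> (\<And>x. x \<in> I \<Longrightarrow> g x \<noteq> 0) \<Longrightarrow> smooth_in I (\<lambda>x. f x / g x)"
  by (simp add: smooth_in_iff divide_inverse differentiable_times_in_mult differentiable_times_in_inverse)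

end

section \<open>The AIM sequences, their three-term recurrence and the determinant\<close>

locale aim = perfect_set +
  fixes l\<^sub>0 s\<^sub>0 :: "real \<Rightarrow> real"
  assumes smooth_l0: "smooth_in I l\<^sub>0" and smooth_s0: "smooth_in I s\<^sub>0"
begin

abbreviation "p \<equiv> aim_p I l\<^sub>0 s\<^sub>0"
abbreviation "q \<equiv> aim_q I l\<^sub>0 s\<^sub>0"

lemma smooth_lambda_s:
  "smooth_in I (aim_lambda I l\<^sub>0 s\<^sub>0 n)" "smooth_in I (aim_s I l\<^sub>0 s\<^sub>0 n)"
  by (induction n)
    (simp_all add: smooth_l0 smooth_s0 smooth_in_add smooth_in_mult smooth_in_deriv_in)

text \<open>The denominators met up to index \<open>n\<close> are \<open>q 0\<close>, ...,
  \<open>q (n - 1)\<close>, exactly those that \<open>aim_pq_defined\<close> keeps away from zero;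
  \<open>q n\<close> itself may vanish.\<close>

lemma smooth_p_q:
  assumes "aim_pq_defined I l\<^sub>0 s\<^sub>0 n"
  shows "smooth_in I (p n)" "smooth_in I (q n)"
proof -
  have "smooth_in I (p n) \<and> smooth_in I (q n)"
    using assms
  proof (induction n)
    case 0
    then show ?case by (simp add: smooth_l0 smooth_s0)
  next
    case (Suc n)
    then have "aim_pq_defined I l\<^sub>0 s\<^sub>0 n" and "\<forall>x\<in>I. q n x \<noteq> 0"
      by (auto simp: aim_pq_defined_def)
    with Suc.IH show ?case
      by (simp add: smooth_in_add smooth_in_diff smooth_in_mult smooth_in_divide smooth_in_deriv_in)
  qed
  then show "smooth_in I (p n)" "smooth_in I (q n)" by auto
qed

(* Indices are shifted by two, so that lam 0 and s 0 stand for index -2. *)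
definition lam :: "nat \<Rightarrow> real \<Rightarrow> real" where
  "lam n = (case n of 0 \<Rightarrow> (\<lambda>x. 0) | Suc 0 \<Rightarrow> (\<lambda>x. 1) | Suc (Suc k) \<Rightarrow> aim_lambda I l\<^sub>0 s\<^sub>0 k)"

definition s :: "nat \<Rightarrow> real \<Rightarrow> real" where
  "s n = (case n of 0 \<Rightarrow> (\<lambda>x. 1) | Suc 0 \<Rightarrow> (\<lambda>x. 0) | Suc (Suc k) \<Rightarrow> aim_s I l\<^sub>0 s\<^sub>0 k)"

lemma smooth_lam: "smooth_in I (lam n)"
  and smooth_s: "smooth_in I (s n)"
  by (auto simp: lam_def s_def smooth_in_const smooth_lambda_s split: nat.split)

text \<open>The two added initial terms encode \<open>y = 0 y' + 1 y\<close> and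
  \<open>y' = 1 y' + 0 y\<close>; differentiating these reproduces the recursion, so it already
  holds from the first index.\<close>

lemma lam_Suc: "x \<in> I \<Longrightarrow> lam (Suc n) x = deriv_in I (lam n) x + l\<^sub>0 x * lam n x + s n x"
  and s_Suc: "x \<in> I \<Longrightarrow> s (Suc n) x = deriv_in I (s n) x + s\<^sub>0 x * lam n x"
  by (auto simp: lam_def s_def deriv_in_const split: nat.split)

text \<open>The product rule applied to the recurrence, stated for a generic \<open>v\<close>
  because it serves both \<open>lam\<close> and \<open>s\<close>.\<close>

lemma three_term_step:
  fixes v :: "nat \<Rightarrow> real \<Rightarrow> real"
  assumes "aim_pq_defined I l\<^sub>0 s\<^sub>0 n" "smooth_in I (v n)" "smooth_in I (v (Suc n))"
    and v: "\<And>x. x \<in> I \<Longrightarrow> v (Suc (Suc n)) x = p n x * v (Suc n) x + q n x * v n x"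
    and x: "x \<in> I"
  shows "deriv_in I (v (Suc (Suc n))) x =
    deriv_in I (p n) x * v (Suc n) x + p n x * deriv_in I (v (Suc n)) x +
    (deriv_in I (q n) x * v n x + q n x * deriv_in I (v n) x)"
proof -
  have "deriv_in I (v (Suc (Suc n))) x = deriv_in I (\<lambda>x. p n x * v (Suc n) x + q n x * v n x) x"
    using v x by (rule deriv_in_cong)
  also have "\<dots> = deriv_in I (p n) x * v (Suc n) x + p n x * deriv_in I (v (Suc n)) x +
      (deriv_in I (q n) x * v n x + q n x * deriv_in I (v n) x)"
    using assms smooth_p_q[OF assms(1)]
    by (simp add: deriv_in_add deriv_in_mult smooth_in_mult smooth_in_imp_differentiable_on)
  finally show ?thesis .
qed

text \<open>Differentiating \<open>y^(n+2) = p_n y^(n+1) + q_n y^(n)\<close> and eliminating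
  \<open>y^(n)\<close> by the same relation yields the definitions of \<open>p_(n+1)\<close> and
  \<open>q_(n+1)\<close>. The proof does this on coefficients; both sequences are treated in one
  induction because the recursion for \<open>lam\<close> involves \<open>s\<close> and vice
  versa.\<close>

lemma three_term:
  assumes "aim_pq_defined I l\<^sub>0 s\<^sub>0 n" "x \<in> I"
  shows "lam (Suc (Suc n)) x = p n x * lam (Suc n) x + q n x * lam n x"
    and "s (Suc (Suc n)) x = p n x * s (Suc n) x + q n x * s n x"
proof -
  have "\<forall>x\<in>I. lam (Suc (Suc n)) x = p n x * lam (Suc n) x + q n x * lam n x \<and>
          s (Suc (Suc n)) x = p n x * s (Suc n) x + q n x * s n x"
    using assms(1)
  proof (induction n)
    case 0
    then show ?case by (simp add: lam_def s_def)
  next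
    case (Suc n)
    then have def: "aim_pq_defined I l\<^sub>0 s\<^sub>0 n" and q: "\<And>x. x \<in> I \<Longrightarrow> q n x \<noteq> 0"
      by (auto simp: aim_pq_defined_def)
    note IH = Suc.IH[OF def]
    show ?case
    proof
      fix x assume x: "x \<in> I"
      \<comment> \<open>With the logarithmic derivative \<open>r\<close> of \<open>q n\<close>, and
        \<open>q n\<close> nonzero, the quotients disappear and the goals become polynomial
        identities.\<close>
      define r where "r = deriv_in I (q n) x / q n x"
      have dq: "deriv_in I (q n) x = r * q n x" using q[OF x] by (simp add: r_def)
      have pq: "p (Suc n) x = p n x + r" "q (Suc n) x = q n x + deriv_in I (p n) x - p n x * r"
        by (simp_all add: r_def)
      have l2: "lam (Suc (Suc n)) x = p n x * lam (Suc n) x + q n x * lam n x"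
        and s2: "s (Suc (Suc n)) x = p n x * s (Suc n) x + q n x * s n x"
        using IH x by auto
      \<comment> \<open>Solving the recursions for the derivatives reduces everything to values of
        \<open>lam\<close> and \<open>s\<close> at \<open>n\<close> and \<open>Suc n\<close>,
        together with \<open>p n\<close>, its derivative, \<open>q n\<close> and
        \<open>r\<close>.\<close>
      have dl0: "deriv_in I (lam n) x = lam (Suc n) x - l\<^sub>0 x * lam n x - s n x"
        and dl1: "deriv_in I (lam (Suc n)) x = lam (Suc (Suc n)) x - l\<^sub>0 x * lam (Suc n) x - s (Suc n) x"
        and ds0: "deriv_in I (s n) x = s (Suc n) x - s\<^sub>0 x * lam n x"
        and ds1: "deriv_in I (s (Suc n)) x = s (Suc (Suc n)) x - s\<^sub>0 x * lam (Suc n) x"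
        using lam_Suc[OF x] s_Suc[OF x] by simp_all
      have dl: "deriv_in I (lam (Suc (Suc n))) x =
          deriv_in I (p n) x * lam (Suc n) x + p n x * deriv_in I (lam (Suc n)) x +
          (r * q n x * lam n x + q n x * deriv_in I (lam n) x)"
        unfolding dq[symmetric] by (rule three_term_step) (use def IH x smooth_lam in auto)
      have ds: "deriv_in I (s (Suc (Suc n))) x =
          deriv_in I (p n) x * s (Suc n) x + p n x * deriv_in I (s (Suc n)) x +
          (r * q n x * s n x + q n x * deriv_in I (s n) x)"
        unfolding dq[symmetric] by (rule three_term_step) (use def IH x smooth_s in auto)
      have "lam (Suc (Suc (Suc n))) x = p (Suc n) x * lam (Suc (Suc n)) x + q (Suc n) x * lam (Suc n) x"
        unfolding lam_Suc[OF x, of "Suc (Suc n)"] dl dl1 dl0 l2 s2 pq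
        by (simp add: algebra_simps del: aim_p.simps aim_q.simps)
      moreover have "s (Suc (Suc (Suc n))) x = p (Suc n) x * s (Suc (Suc n)) x + q (Suc n) x * s (Suc n) x"
        unfolding s_Suc[OF x, of "Suc (Suc n)"] ds ds1 ds0 l2 s2 pq
        by (simp add: algebra_simps del: aim_p.simps aim_q.simps)
      ultimately show "lam (Suc (Suc (Suc n))) x = p (Suc n) x * lam (Suc (Suc n)) x + q (Suc n) x * lam (Suc n) x \<and>
          s (Suc (Suc (Suc n))) x = p (Suc n) x * s (Suc (Suc n)) x + q (Suc n) x * s (Suc n) x" ..
    qed
  qed
  with assms(2) show "lam (Suc (Suc n)) x = p n x * lam (Suc n) x + q n x * lam n x"
    and "s (Suc (Suc n)) x = p n x * s (Suc n) x + q n x * s n x" by auto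
qed

text \<open>A Casoratian argument: the recurrence advances both sequences by the matrix with rows
  \<open>(p, q)\<close> and \<open>(1, 0)\<close>, of determinant \<open>- q\<close>, so the
  \<open>p\<close> terms cancel. The initial value is \<open>q 0\<close>, with sign plus.\<close>

lemma determinant_eq_prod:
  assumes "aim_pq_defined I l\<^sub>0 s\<^sub>0 n" "x \<in> I"
  shows "s (Suc (Suc n)) x * lam (Suc n) x - lam (Suc (Suc n)) x * s (Suc n) x =
    (- 1) ^ n * (\<Prod>k\<le>n. q k x)"
  using assms(1)
proof (induction n)
  case 0
  then show ?case by (simp add: lam_def s_def)
next
  case (Suc n)
  then have "aim_pq_defined I l\<^sub>0 s\<^sub>0 n" by (simp add: aim_pq_defined_def)
  note IH = Suc.IH[OF this]
  have "s (Suc (Suc (Suc n))) x * lam (Suc (Suc n)) x - lam (Suc (Suc (Suc n))) x * s (Suc (Suc n)) x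
      = - q (Suc n) x * (s (Suc (Suc n)) x * lam (Suc n) x - lam (Suc (Suc n)) x * s (Suc n) x)"
    unfolding three_term[OF Suc.prems assms(2)]
    by (simp add: algebra_simps del: aim_p.simps aim_q.simps)
  then show ?case unfolding IH by (simp add: mult_ac del: aim_q.simps)
qed

text \<open>Over the common denominator, the difference of the two quotients has the determinant as
  numerator. Among the factors \<open>q 0\<close>, ..., \<open>q N\<close> only the last can vanish,
  so the equivalence is even pointwise.\<close>

lemma alpha_terminates_iff_q_terminates:
  assumes "N \<ge> 1" "aim_alpha_defined I l\<^sub>0 s\<^sub>0 N" "aim_alpha_defined I l\<^sub>0 s\<^sub>0 (N - 1)"
    and pq: "aim_pq_defined I l\<^sub>0 s\<^sub>0 N"
  shows "alpha_terminates I l\<^sub>0 s\<^sub>0 N \<longleftrightarrow> q_terminates I l\<^sub>0 s\<^sub>0 N"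
proof -
  \<comment> \<open>This form lets \<open>lam (Suc N)\<close> unfold to the genuine term of index
    \<open>N - 1\<close> instead of an added initial term.\<close>
  obtain m where N: "N = Suc m" using assms(1) by (cases N) auto
  have "aim_alpha I l\<^sub>0 s\<^sub>0 N x - aim_alpha I l\<^sub>0 s\<^sub>0 (N - 1) x = 0 \<longleftrightarrow> q N x = 0" if x: "x \<in> I" for x
  proof -
    have "aim_lambda I l\<^sub>0 s\<^sub>0 (Suc m) x \<noteq> 0" "aim_lambda I l\<^sub>0 s\<^sub>0 m x \<noteq> 0"
      using assms(2,3) x by (auto simp: aim_alpha_defined_def N)
    then have "aim_alpha I l\<^sub>0 s\<^sub>0 N x - aim_alpha I l\<^sub>0 s\<^sub>0 (N - 1) x = 0 \<longleftrightarrow>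
        s (Suc (Suc N)) x * lam (Suc N) x - lam (Suc (Suc N)) x * s (Suc N) x = 0"
      by (simp add: aim_alpha_def N lam_def s_def frac_eq_eq mult.commute
          del: aim_lambda.simps aim_s.simps)
    also have "\<dots> \<longleftrightarrow> (\<Prod>k\<le>N. q k x) = 0"
      unfolding determinant_eq_prod[OF pq x] by simp
    also have "\<dots> \<longleftrightarrow> q N x = 0"
      using pq x by (auto simp: aim_pq_defined_def le_less)
    finally show ?thesis .
  qed
  then show ?thesis by (simp add: alpha_terminates_def q_terminates_def)
qed

end

text \<open>The first conjunct compares the conditions at one index. In the second, the dichotomy
  says that the \<open>p\<close>, \<open>q\<close> recursion stops only because some
  \<open>q n\<close> with \<open>n\<close> positive vanishes on all of \<open>I\<close>; requiring
  \<open>aim_pq_defined\<close> at the witness rules out a zero of \<open>q N\<close> produced by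
  the convention \<open>x / 0 = 0\<close>.\<close>

theorem mainTheorem5:
  fixes I :: "real set" and l\<^sub>0 s\<^sub>0 :: "real \<Rightarrow> real"
  assumes "is_interval I" and "\<exists>a\<in>I. \<exists>b\<in>I. a < b"
    and "smooth_in I l\<^sub>0" and "smooth_in I s\<^sub>0"
    and "\<forall>x\<in>I. l\<^sub>0 x \<noteq> 0"
  shows "(\<forall>N\<ge>1.
            aim_alpha_defined I l\<^sub>0 s\<^sub>0 N \<and> aim_alpha_defined I l\<^sub>0 s\<^sub>0 (N - 1) \<and> aim_pq_defined I l\<^sub>0 s\<^sub>0 N
            \<longrightarrow> (alpha_terminates I l\<^sub>0 s\<^sub>0 N \<longleftrightarrow> q_terminates I l\<^sub>0 s\<^sub>0 N))
       \<and> ((\<forall>n. aim_alpha_defined I l\<^sub>0 s\<^sub>0 n)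
            \<and> (\<forall>n. aim_pq_defined I l\<^sub>0 s\<^sub>0 n \<longrightarrow>
                   aim_pq_defined I l\<^sub>0 s\<^sub>0 (Suc n) \<or> (n \<ge> 1 \<and> q_terminates I l\<^sub>0 s\<^sub>0 n))
          \<longrightarrow> ((\<exists>N\<ge>1. alpha_terminates I l\<^sub>0 s\<^sub>0 N)
               \<longleftrightarrow> (\<exists>N\<ge>1. aim_pq_defined I l\<^sub>0 s\<^sub>0 N \<and> q_terminates I l\<^sub>0 s\<^sub>0 N)))"
proof -
  have "aim I l\<^sub>0 s\<^sub>0"
  proof
    obtain a b where ab: "a \<in> I" "b \<in> I" "a < b" using assms(2) by blast
    show "at x within I \<noteq> bot" if "x \<in> I" for x
      \<comment> \<open>A connected set with two distinct points is not a singleton, hence has no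
        isolated point.\<close>
      using connected_imp_perfect[of I x] assms(1) ab that
      by (metis is_interval_connected less_irrefl singletonD trivial_limit_within)
  qed (use assms in auto)
  then interpret aim I l\<^sub>0 s\<^sub>0 .
  note eq = alpha_terminates_iff_q_terminates
  have "\<exists>N\<ge>1. aim_pq_defined I l\<^sub>0 s\<^sub>0 N \<and> q_terminates I l\<^sub>0 s\<^sub>0 N"
    if def: "\<forall>n. aim_alpha_defined I l\<^sub>0 s\<^sub>0 n"
      and step: "\<forall>n. aim_pq_defined I l\<^sub>0 s\<^sub>0 n \<longrightarrow>
        aim_pq_defined I l\<^sub>0 s\<^sub>0 (Suc n) \<or> (n \<ge> 1 \<and> q_terminates I l\<^sub>0 s\<^sub>0 n)"
      and N: "N \<ge> 1" "alpha_terminates I l\<^sub>0 s\<^sub>0 N" for N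
  \<comment> \<open>If \<open>q\<close> never terminates, the dichotomy carries well-definedness to
    every index, and the equivalence at the given \<open>N\<close> is contradicted. No fixed witness
    is named, since \<open>q\<close> may vanish before index \<open>N\<close>.\<close>
  proof (rule ccontr)
    assume none: "\<not> ?thesis"
    have "aim_pq_defined I l\<^sub>0 s\<^sub>0 n" for n
    proof (induction n)
      case 0
      show ?case by (simp add: aim_pq_defined_def)
    next
      case (Suc n)
      with none step show ?case by blast
    qed
    with none def eq N show False by blast
  qed
  with eq show ?thesis by blast
qed

end
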